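(* Let $G_1\leqslant\mathrm{Sym}(\Omega_1)$ and $G_2\leqslant\mathrm{Sym}(\Omega_2)$ be semiprimitive groups with plinths $K_1$ and $K_2$. Let $\omega_1\in\Omega_1$ and $\omega_2\in\Omega_2$ and suppose there is an isomorphism $\mu:(G_1)_{\omega_1}\to(G_2)_{\omega_2}$ such that $(K_1)_{\omega_1}\mu=(K_2)_{\omega_2}$. Then there exists a semiprimitive group $G$ with a plinth isomorphic to $K_1\times K_2$ and point-stabilisers isomorphic to $(G_1)_{\omega_1}$ such that $G_1$ and $G_2$ are (up to permutational isomorphism) quotient actions of $G$ via normal subgroups.
   Context: Sets may be infinite. A permutation group is semiregular if all its point-stabilisers are trivial. A transitive permutation group is semiprimitive if every normal subgroup is transitive or semiregular. A plinth of a transitive group $G$ is a transitive normal subgroup $K$ of $G$ such that no proper subgroup of $K$ that is normal in $G$ is transitive. The quotient action of $G$ via a normal subgroup $N$ is the action of $G$ on the set of $N$-orbits, regarded as the permutation group induced by $G$ on that set. *)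

theory Defs
  imports "HOL-Algebra.Group_Action"
begin

text \<open>
  A permutation group on \<open>\<Omega>\<close> is a set \<open>G\<close> with \<open>subgroup G (BijGroup \<Omega>)\<close>, acting by
  evaluation. \<open>BijGroup\<close> composes from right to left; this replaces every permutation group
  written on the right by its opposite and affects neither orbits, stabilisers and normal
  subgroups nor which maps are isomorphisms.
\<close>

abbreviation perm_group :: "'a set \<Rightarrow> ('a \<Rightarrow> 'a) set \<Rightarrow> ('a \<Rightarrow> 'a) monoid"
  where "perm_group \<Omega> G \<equiv> (BijGroup \<Omega>)\<lparr>carrier := G\<rparr>"

abbreviation point_stabilizer :: "'a set \<Rightarrow> ('a \<Rightarrow> 'a) set \<Rightarrow> 'a \<Rightarrow> ('a \<Rightarrow> 'a) set"
  where "point_stabilizer \<Omega> G \<omega> \<equiv> stabilizer (perm_group \<Omega> G) (\<lambda>g. g) \<omega>"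

definition transitive :: "'a set \<Rightarrow> ('a \<Rightarrow> 'a) set \<Rightarrow> bool"
  where "transitive \<Omega> G \<longleftrightarrow> transitive_action (perm_group \<Omega> G) \<Omega> (\<lambda>g. g)"

definition semiregular :: "'a set \<Rightarrow> ('a \<Rightarrow> 'a) set \<Rightarrow> bool"
  where "semiregular \<Omega> G \<longleftrightarrow> (\<forall>\<omega>\<in>\<Omega>. point_stabilizer \<Omega> G \<omega> = {\<one>\<^bsub>BijGroup \<Omega>\<^esub>})"

definition semiprimitive :: "'a set \<Rightarrow> ('a \<Rightarrow> 'a) set \<Rightarrow> bool"
  where "semiprimitive \<Omega> G \<longleftrightarrow>
    subgroup G (BijGroup \<Omega>) \<and> transitive \<Omega> G \<and>
    (\<forall>N. N \<lhd> perm_group \<Omega> G \<longrightarrow> transitive \<Omega> N \<or> semiregular \<Omega> N)"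

definition plinth :: "'a set \<Rightarrow> ('a \<Rightarrow> 'a) set \<Rightarrow> ('a \<Rightarrow> 'a) set \<Rightarrow> bool"
  where "plinth \<Omega> G K \<longleftrightarrow>
    K \<lhd> perm_group \<Omega> G \<and> transitive \<Omega> K \<and>
    (\<forall>L. L \<lhd> perm_group \<Omega> G \<and> L \<subset> K \<longrightarrow> \<not> transitive \<Omega> L)"

abbreviation orbit_set :: "'a set \<Rightarrow> ('a \<Rightarrow> 'a) set \<Rightarrow> 'a set set"
  where "orbit_set \<Omega> N \<equiv> orbits (perm_group \<Omega> N) \<Omega> (\<lambda>g. g)"

text \<open>The permutation group on \<open>orbit_set \<Omega> N\<close> induced by \<open>G\<close>, for \<open>N\<close> normal in \<open>G\<close>.\<close>

definition quotient_action ::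
    "'a set \<Rightarrow> ('a \<Rightarrow> 'a) set \<Rightarrow> ('a \<Rightarrow> 'a) set \<Rightarrow> ('a set \<Rightarrow> 'a set) set"
  where "quotient_action \<Omega> G N = (\<lambda>g. \<lambda>B\<in>orbit_set \<Omega> N. g ` B) ` G"

definition permutationally_isomorphic ::
    "'a set \<Rightarrow> ('a \<Rightarrow> 'a) set \<Rightarrow> 'b set \<Rightarrow> ('b \<Rightarrow> 'b) set \<Rightarrow> bool"
  where "permutationally_isomorphic \<Omega> G \<Delta> H \<longleftrightarrow>
    (\<exists>\<beta> \<psi>. bij_betw \<beta> \<Omega> \<Delta> \<and> \<psi> \<in> iso (perm_group \<Omega> G) (perm_group \<Delta> H) \<and>
      (\<forall>g\<in>G. \<forall>x\<in>\<Omega>. \<beta> (g x) = \<psi> g (\<beta> x)))"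

definition is_quotient_action_of ::
    "'a set \<Rightarrow> ('a \<Rightarrow> 'a) set \<Rightarrow> 'b set \<Rightarrow> ('b \<Rightarrow> 'b) set \<Rightarrow> bool"
  where "is_quotient_action_of \<Delta> H \<Omega> G \<longleftrightarrow>
    (\<exists>N. N \<lhd> perm_group \<Omega> G \<and>
      permutationally_isomorphic \<Delta> H (orbit_set \<Omega> N) (quotient_action \<Omega> G N))"

text \<open>
  HOL cannot quantify existentially over types, so an existence claim about a permutation group
  has to name the type of its points. A coset space of a subgroup of \<open>G\<^sub>1 \<times> G\<^sub>2\<close> lives in the
  following type.
\<close>

type_synonym ('a, 'b) pair_coset = "(('a \<Rightarrow> 'a) \<times> ('b \<Rightarrow> 'b)) set"

end

theory Submission
  imports Defs "HOL-Algebra.SndIsomorphismGrp" "HOL-Algebra.Left_Coset"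
begin

text \<open>
  Let \<open>S \<le> G\<^sub>1 \<times> G\<^sub>2\<close> be the graph of \<open>\<mu>\<close> and let \<open>X = (K\<^sub>1 \<times> K\<^sub>2) S\<close> act on the cosets of \<open>S\<close>. Both
  projections of \<open>X\<close> are onto and injective on \<open>S\<close>. For \<open>N\<close> normal in \<open>X\<close> put
  \<open>A = {k. (k, 1) \<in> N}\<close>, a normal subgroup of \<open>G\<^sub>1\<close> inside \<open>K\<^sub>1\<close>. If \<open>A\<close> is transitive then \<open>A = K\<^sub>1\<close>,
  so \<open>N\<close> contains \<open>K\<^sub>1 \<times> 1\<close> and is determined by its projection to \<open>G\<^sub>2\<close>. Otherwise the projection
  \<open>M\<close> of \<open>N\<close> to \<open>G\<^sub>1\<close> satisfies \<open>[M, K\<^sub>1] \<le> A\<close>; a point stabiliser in \<open>M\<close> then fixes every \<open>A\<close>-orbit,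
  and since the kernel of \<open>G\<^sub>1\<close> on these orbits is intransitive, hence semiregular, \<open>M\<close> is
  semiregular. Both semiprimitivity of \<open>X\<close> and minimality of \<open>K\<^sub>1 \<times> K\<^sub>2\<close> follow from this dichotomy.
\<close>

section \<open>Semiprimitivity relative to a subgroup\<close>

text \<open>
  A pair \<open>(G, H)\<close> stands for a transitive action of \<open>G\<close> with point stabiliser \<open>H\<close>: a normal subgroup
  \<open>N\<close> is transitive iff \<open>N H = G\<close>, and semiregular iff \<open>N \<inter> H = 1\<close>.
\<close>

definition supplement :: "('a, 'm) monoid_scheme \<Rightarrow> 'a set \<Rightarrow> 'a set \<Rightarrow> bool"
  where "supplement G H N \<longleftrightarrow> N <#>\<^bsub>G\<^esub> H = carrier G"

definition semiprimitive_pair :: "('a, 'm) monoid_scheme \<Rightarrow> 'a set \<Rightarrow> bool"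
  where "semiprimitive_pair G H \<longleftrightarrow>
    subgroup H G \<and> (\<forall>N. N \<lhd> G \<longrightarrow> supplement G H N \<or> N \<inter> H = {\<one>\<^bsub>G\<^esub>})"

definition plinth_pair :: "('a, 'm) monoid_scheme \<Rightarrow> 'a set \<Rightarrow> 'a set \<Rightarrow> bool"
  where "plinth_pair G H K \<longleftrightarrow>
    K \<lhd> G \<and> supplement G H K \<and> (\<forall>L. L \<lhd> G \<and> L \<subseteq> K \<and> supplement G H L \<longrightarrow> L = K)"

section \<open>Elementary facts on supplements and homomorphic images\<close>

lemma supplementD:
  assumes "supplement G H N" "g \<in> carrier G"
  obtains n h where "n \<in> N" "h \<in> H" "g = n \<otimes>\<^bsub>G\<^esub> h"
  using assms unfolding supplement_def set_mult_def by blast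

lemma (in group) supplementI:
  assumes "N \<subseteq> carrier G" "H \<subseteq> carrier G"
    and "\<And>g. g \<in> carrier G \<Longrightarrow> \<exists>n\<in>N. \<exists>h\<in>H. g = n \<otimes> h"
  shows "supplement G H N"
  using assms unfolding supplement_def set_mult_def by blast

lemma (in group) inv_cancel_left:
  assumes "x \<in> carrier G" "y \<in> carrier G"
  shows "x \<otimes> (inv x \<otimes> y) = y" "inv x \<otimes> (x \<otimes> y) = y"
  using assms by (simp_all flip: m_assoc)

lemma (in group) conjugate_eq_oneD:
  assumes "g \<in> carrier G" "x \<in> carrier G" "inv g \<otimes> x \<otimes> g = \<one>"
  shows "x = \<one>"
proof -
  have "x = g \<otimes> (inv g \<otimes> x \<otimes> g) \<otimes> inv g"
    using assms(1,2) by (simp add: m_assoc inv_cancel_left)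
  then show ?thesis using assms by simp
qed

lemma (in group_hom) normal_image:
  assumes "N \<lhd> G" "h ` carrier G = carrier H"
  shows "h ` N \<lhd> H"
proof (rule H.normal_invI)
  show "subgroup (h ` N) H"
    using assms(1) normal_imp_subgroup subgroup_img_is_subgroup by blast
  fix y x assume "y \<in> carrier H" "x \<in> h ` N"
  then obtain g n where g: "g \<in> carrier G" "y = h g" "n \<in> N" "x = h n"
    using assms(2) by blast
  then have "n \<in> carrier G" "g \<otimes> n \<otimes> inv g \<in> N"
    using assms(1) G.normal_invE(2)[OF assms(1)] by (auto dest: normal_imp_subgroup subgroup.mem_carrier)
  moreover have "h (g \<otimes> n \<otimes> inv g) = y \<otimes>\<^bsub>H\<^esub> x \<otimes>\<^bsub>H\<^esub> inv\<^bsub>H\<^esub> y"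
    using g calculation(1) by simp
  ultimately show "y \<otimes>\<^bsub>H\<^esub> x \<otimes>\<^bsub>H\<^esub> inv\<^bsub>H\<^esub> y \<in> h ` N"
    by (metis image_eqI)
qed

lemma (in group_hom) supplement_image:
  assumes "supplement G S N" "N \<subseteq> carrier G" "S \<subseteq> carrier G" "h ` carrier G = carrier H"
  shows "supplement H (h ` S) (h ` N)"
proof (rule H.supplementI)
  show "h ` N \<subseteq> carrier H" "h ` S \<subseteq> carrier H"
    using assms(2-4) by blast+
  fix y assume "y \<in> carrier H"
  then obtain x where x: "x \<in> carrier G" "y = h x" using assms(4) by blast
  then obtain n s where "n \<in> N" "s \<in> S" "x = n \<otimes> s"
    using assms(1) supplementD by metis
  then show "\<exists>n\<in>h ` N. \<exists>s\<in>h ` S. y = n \<otimes>\<^bsub>H\<^esub> s"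
    using x assms(2,3) hom_mult by (metis imageI subsetD)
qed

text \<open>The subgroup \<open>E\<close> in the proof is the kernel of \<open>G\<close> on the orbits of \<open>A\<close>.\<close>

lemma (in group) centraliser_mod_intransitive:
  assumes sp: "semiprimitive_pair G H" and A: "A \<lhd> G" "\<not> supplement G H A"
    and K: "K \<subseteq> carrier G" "supplement G H K" and N: "N \<subseteq> carrier G" "\<one> \<in> N"
    and comm: "\<And>n k. \<lbrakk>n \<in> N; k \<in> K\<rbrakk> \<Longrightarrow> inv k \<otimes> n \<otimes> k \<otimes> inv n \<in> A"
  shows "N \<inter> H = {\<one>}"
proof -
  interpret H: subgroup H G using sp by (simp add: semiprimitive_pair_def)
  interpret A: normal A G by fact
  have AH: "subgroup (A <#> H) G"
    using A(1) H.subgroup_axioms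
    by (simp add: normal_subgroup_set_mult_closed second_isomorphism_grp.intro
        second_isomorphism_grp.normal_set_mult_subgroup second_isomorphism_grp_axioms.intro)
  define E where "E = {g \<in> carrier G. \<forall>x \<in> carrier G. inv x \<otimes> g \<otimes> x \<in> A <#> H}"
  have "E \<lhd> G"
  proof (rule normal_invI)
    show "subgroup E G"
    proof
      show "E \<subseteq> carrier G" by (auto simp: E_def)
      show "\<one> \<in> E" using subgroup.one_closed[OF AH] by (simp add: E_def)
      fix g assume g: "g \<in> E"
      show "inv g \<in> E"
      proof -
        have "inv x \<otimes> inv g \<otimes> x = inv (inv x \<otimes> g \<otimes> x)" if "x \<in> carrier G" for x
          using that g by (simp add: E_def inv_mult_group m_assoc)
        then show ?thesis using g subgroup.m_inv_closed[OF AH] by (simp add: E_def)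
      qed
      fix g' assume g': "g' \<in> E"
      have "inv x \<otimes> (g \<otimes> g') \<otimes> x = (inv x \<otimes> g \<otimes> x) \<otimes> (inv x \<otimes> g' \<otimes> x)"
        if "x \<in> carrier G" for x
        using that g g' by (simp add: E_def m_assoc inv_cancel_left)
      then show "g \<otimes> g' \<in> E" using g g' subgroup.m_closed[OF AH] by (simp add: E_def)
    qed
    fix x g assume x: "x \<in> carrier G" and g: "g \<in> E"
    have "inv y \<otimes> (x \<otimes> g \<otimes> inv x) \<otimes> y = inv (inv x \<otimes> y) \<otimes> g \<otimes> (inv x \<otimes> y)"
      if "y \<in> carrier G" for y
      using that x g by (simp add: E_def inv_mult_group m_assoc)
    then show "x \<otimes> g \<otimes> inv x \<in> E" using x g by (simp add: E_def)
  qed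
  \<comment> \<open>Taking \<open>x = \<one>\<close> shows that \<open>E\<close> lies inside
    \<open>A <#> H\<close>, so \<open>E\<close> cannot supplement \<open>H\<close> unless
    \<open>A\<close> does. Semiprimitivity then makes \<open>E \<inter> H\<close> trivial, and it
    remains to place \<open>N \<inter> H\<close> inside \<open>E\<close>.\<close>
  moreover have "\<not> supplement G H E"
  proof
    assume *: "supplement G H E"
    have "supplement G H A"
    proof (rule supplementI)
      fix g assume "g \<in> carrier G"
      with * obtain e h where e: "e \<in> E" "h \<in> H" "g = e \<otimes> h" by (rule supplementD)
      then have "inv \<one> \<otimes> e \<otimes> \<one> \<in> A <#> H" unfolding E_def by blast
      then have "e \<in> A <#> H" using e by (simp add: E_def)
      then obtain a h' where "a \<in> A" "h' \<in> H" "e = a \<otimes> h'" by (auto simp: set_mult_def)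
      then have "g = a \<otimes> (h' \<otimes> h)" "h' \<otimes> h \<in> H" using e by (auto simp: m_assoc)
      then show "\<exists>a\<in>A. \<exists>h\<in>H. g = a \<otimes> h" using \<open>a \<in> A\<close> by blast
    qed (use A.subset H.subset in auto)
    with A(2) show False ..
  qed
  ultimately have E1: "E \<inter> H = {\<one>}" using sp by (auto simp: semiprimitive_pair_def)
  have "s = \<one>" if s: "s \<in> N" "s \<in> H" for s
  proof -
    have "inv x \<otimes> s \<otimes> x \<in> A <#> H" if x: "x \<in> carrier G" for x
    proof -
      obtain k t where k: "k \<in> K" "t \<in> H" "x = k \<otimes> t" using K(2) x by (rule supplementD)
      \<comment> \<open>For \<open>x = k \<otimes> t\<close> the conjugate of \<open>s\<close> by
        \<open>x\<close> is \<open>a\<close> times the conjugate of \<open>s\<close> by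
        \<open>t\<close>. The factor \<open>a\<close> is a commutator of \<open>s\<close> and
        \<open>k\<close>, placed in \<open>A\<close> by \<open>comm\<close>, conjugated by
        \<open>t\<close>; the other factor stays in \<open>H\<close>.\<close>
      define a where "a = inv t \<otimes> (inv k \<otimes> s \<otimes> k \<otimes> inv s) \<otimes> t"
      have "a \<in> A"
        unfolding a_def using comm[OF s(1) k(1)] k(2) A.inv_op_closed1 by simp
      moreover have "inv t \<otimes> s \<otimes> t \<in> H" using s k by simp
      moreover have "inv x \<otimes> s \<otimes> x = a \<otimes> (inv t \<otimes> s \<otimes> t)"
        using k s K(1) by (simp add: a_def inv_mult_group m_assoc subset_iff inv_cancel_left)
      ultimately show ?thesis by (auto simp: set_mult_def)
    qed
    then have "s \<in> E" using s by (simp add: E_def)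
    then show ?thesis using E1 s by blast
  qed
  then show ?thesis using N H.one_closed by blast
qed

section \<open>Transport along isomorphisms\<close>

text \<open>Serves to pass from an abstract group to its image under a faithful action. A normal
  subgroup of \<open>Y\<close> is pulled back by the inverse isomorphism, and whichever alternative
  holds in \<open>X\<close> is pushed forward again.\<close>

lemma iso_semiprimitive_pair:
  assumes "group X" "group Y" and \<phi>: "\<phi> \<in> iso X Y" and sp: "semiprimitive_pair X H"
  shows "semiprimitive_pair Y (\<phi> ` H)"
proof -
  interpret X: group X by fact
  interpret Y: group Y by fact
  interpret \<phi>: group_hom X Y \<phi>
    using \<phi> by unfold_locales (simp add: iso_def)
  define \<phi>' where "\<phi>' = inv_into (carrier X) \<phi>"
  have bij: "bij_betw \<phi> (carrier X) (carrier Y)" using \<phi> by (simp add: iso_def)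
  have \<phi>': "\<phi>' \<in> iso Y X" using X.iso_set_sym[OF \<phi>] by (simp add: \<phi>'_def)
  interpret \<phi>': group_hom Y X \<phi>'
    using \<phi>' by unfold_locales (simp add: iso_def)
  have H: "subgroup H X" using sp by (simp add: semiprimitive_pair_def)
  then have HX: "H \<subseteq> carrier X" by (rule subgroup.subset)
  have "supplement Y (\<phi> ` H) N \<or> N \<inter> \<phi> ` H = {\<one>\<^bsub>Y\<^esub>}" if N: "N \<lhd> Y" for N
  proof -
    have N': "\<phi>' ` N \<lhd> X"
      using \<phi>' N by (intro \<phi>'.normal_image) (simp_all add: iso_iff)
    have NY: "N \<subseteq> carrier Y" using N normal_imp_subgroup subgroup.subset by blast
    have img: "\<phi> ` \<phi>' ` N = N"
      unfolding \<phi>'_def using NY bij by (simp add: bij_betw_def image_inv_into_cancel)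
    have N'X: "\<phi>' ` N \<subseteq> carrier X" using NY by auto
    consider "supplement X H (\<phi>' ` N)" | "\<phi>' ` N \<inter> H = {\<one>\<^bsub>X\<^esub>}"
      using sp N' unfolding semiprimitive_pair_def by blast
    then show ?thesis
    proof cases
      case 1
      then have "supplement Y (\<phi> ` H) (\<phi> ` \<phi>' ` N)"
        using N'X HX bij by (intro \<phi>.supplement_image) (simp_all add: bij_betw_def)
      then show ?thesis by (simp add: img)
    next
      case 2
      have "\<phi> ` \<phi>' ` N \<inter> \<phi> ` H = \<phi> ` (\<phi>' ` N \<inter> H)"
        using inj_on_image_Int[OF _ N'X HX] bij by (metis bij_betw_def)
      then show ?thesis using 2 by (simp add: img)
    qed
  qed
  then show ?thesis
    unfolding semiprimitive_pair_def using \<phi>.subgroup_img_is_subgroup[OF H] by blast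
qed

text \<open>Minimality is checked by pulling back: a normal supplement below the image of
  \<open>K\<close> comes from one below \<open>K\<close>, which must be \<open>K\<close>
  itself.\<close>

lemma iso_plinth_pair:
  assumes "group X" "group Y" and \<phi>: "\<phi> \<in> iso X Y" and HX: "H \<subseteq> carrier X"
    and pl: "plinth_pair X H K"
  shows "plinth_pair Y (\<phi> ` H) (\<phi> ` K)"
proof -
  interpret X: group X by fact
  interpret Y: group Y by fact
  interpret \<phi>: group_hom X Y \<phi>
    using \<phi> by unfold_locales (simp add: iso_def)
  define \<phi>' where "\<phi>' = inv_into (carrier X) \<phi>"
  have bij: "bij_betw \<phi> (carrier X) (carrier Y)" using \<phi> by (simp add: iso_def)
  have \<phi>': "\<phi>' \<in> iso Y X" using X.iso_set_sym[OF \<phi>] by (simp add: \<phi>'_def)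
  interpret \<phi>': group_hom Y X \<phi>'
    using \<phi>' by unfold_locales (simp add: iso_def)
  have surj: "\<phi> ` carrier X = carrier Y" "\<phi>' ` carrier Y = carrier X"
    using \<phi> \<phi>' by (simp_all add: iso_iff)
  have K: "K \<lhd> X" "supplement X H K" using pl by (simp_all add: plinth_pair_def)
  have KX: "K \<subseteq> carrier X" using K normal_imp_subgroup subgroup.subset by blast
  have inv1: "\<phi>' ` \<phi> ` S = S" if "S \<subseteq> carrier X" for S
    using that bij unfolding \<phi>'_def by (simp add: bij_betw_def inv_into_image_cancel)
  have inv2: "\<phi> ` \<phi>' ` S = S" if "S \<subseteq> carrier Y" for S
    using that bij unfolding \<phi>'_def by (simp add: bij_betw_def image_inv_into_cancel)
  have "L = \<phi> ` K" if L: "L \<lhd> Y" "L \<subseteq> \<phi> ` K" "supplement Y (\<phi> ` H) L" for L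
  proof -
    have LY: "L \<subseteq> carrier Y" using L normal_imp_subgroup subgroup.subset by blast
    have "\<phi>' ` L \<lhd> X" using L(1) surj by (intro \<phi>'.normal_image)
    moreover have "\<phi>' ` L \<subseteq> K" using image_mono[OF L(2), of \<phi>'] inv1[OF KX] by simp
    moreover have "supplement X H (\<phi>' ` L)"
      using \<phi>'.supplement_image[OF L(3) LY _ surj(2)] image_mono[OF HX, of \<phi>] inv1[OF HX]
      by (simp add: surj(1))
    ultimately have "\<phi>' ` L = K" using pl by (simp add: plinth_pair_def)
    then show ?thesis using inv2[OF LY] by simp
  qed
  moreover have "\<phi> ` K \<lhd> Y" "supplement Y (\<phi> ` H) (\<phi> ` K)"
    using \<phi>.normal_image[OF K(1) surj(1)] \<phi>.supplement_image[OF K(2) KX HX surj(1)] by auto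
  ultimately show ?thesis by (auto simp: plinth_pair_def)
qed

section \<open>Subdirect products\<close>

text \<open>By \<open>joint_inj\<close> the group \<open>X\<close> embeds into the product of
  \<open>A\<close> and \<open>B\<close>. Together \<open>split\<close> and \<open>kernel_q\<close>
  say that \<open>p\<close> maps the kernel of \<open>q\<close> onto the image of \<open>K\<close>,
  so this kernel is the copy of the first plinth inside \<open>X\<close>.\<close>

locale subdirect_pair =
  p: group_hom X A p + q: group_hom X B q
  for X :: "('x, 'm) monoid_scheme" (structure) and A :: "('y, 'k) monoid_scheme"
    and p and B :: "('z, 'l) monoid_scheme" and q +
  fixes H K
  assumes p_surj: "p ` carrier X = carrier A" and q_surj: "q ` carrier X = carrier B"
    and joint_inj: "\<lbrakk>x \<in> carrier X; p x = \<one>\<^bsub>A\<^esub>; q x = \<one>\<^bsub>B\<^esub>\<rbrakk> \<Longrightarrow> x = \<one>"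
    and H: "subgroup H X" and p_inj: "inj_on p H" and q_inj: "inj_on q H"
    and K: "K \<lhd> X" "supplement X H K"
    and split: "k \<in> K \<Longrightarrow> \<exists>k'\<in>K. p k' = p k \<and> q k' = \<one>\<^bsub>B\<^esub>"
    and kernel_q: "\<lbrakk>x \<in> carrier X; q x = \<one>\<^bsub>B\<^esub>\<rbrakk> \<Longrightarrow> x \<in> K"
    and A: "semiprimitive_pair A (p ` H)" "plinth_pair A (p ` H) (p ` K)"
    and B: "semiprimitive_pair B (q ` H)" "plinth_pair B (q ` H) (q ` K)"
begin

sublocale H: subgroup H X by (rule H)
sublocale K: normal K X by (rule K)

text \<open>As \<open>p\<close> and \<open>q\<close> are injective on \<open>H\<close>, an element
  of \<open>N \<inter> H\<close> is trivial as soon as one of its images is. Semiregularity in one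
  factor is therefore enough.\<close>

lemma H_inter_trivial:
  assumes "N \<subseteq> carrier X" "\<one> \<in> N" and "p ` N \<inter> p ` H = {\<one>\<^bsub>A\<^esub>} \<or> q ` N \<inter> q ` H = {\<one>\<^bsub>B\<^esub>}"
  shows "N \<inter> H = {\<one>}"
proof -
  have "x = \<one>" if "x \<in> N" "x \<in> H" for x
    using assms(3)
  proof
    assume "p ` N \<inter> p ` H = {\<one>\<^bsub>A\<^esub>}"
    then have "p x = p \<one>" using that by auto
    then show ?thesis using p_inj that H.one_closed by (meson inj_onD)
  next
    assume "q ` N \<inter> q ` H = {\<one>\<^bsub>B\<^esub>}"
    then have "q x = q \<one>" using that by auto
    then show ?thesis using q_inj that H.one_closed by (meson inj_onD)
  qed
  then show ?thesis using assms(2) H.one_closed by blast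
qed

text \<open>The dichotomy is decided by whether the part of \<open>N\<close> with trivial
  \<open>q\<close>-image projects to a transitive subgroup of \<open>A\<close>. In case
  \<open>kernel\<close> the subgroup \<open>N\<close> is a full preimage under \<open>q\<close>;
  case \<open>trivial\<close> is semiregularity in \<open>A\<close>.\<close>

lemma normal_cases:
  assumes N: "N \<lhd> X"
  obtains (kernel) "\<And>x. \<lbrakk>x \<in> carrier X; q x = \<one>\<^bsub>B\<^esub>\<rbrakk> \<Longrightarrow> x \<in> N"
    | (trivial) "p ` N \<inter> p ` H = {\<one>\<^bsub>A\<^esub>}"
proof -
  interpret N: normal N X by fact
  define A1 where "A1 = p ` (N \<inter> kernel X B q)"
  have A1: "A1 \<lhd> A"
    unfolding A1_def
    using p.normal_image p_surj p.G.normal_subgroup_intersect[OF N q.normal_kernel] by blast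
  show thesis
  proof (cases "supplement A (p ` H) A1")
    case True
    \<comment> \<open>By \<open>kernel_q\<close> the group \<open>A1\<close> lies below the plinth
      of \<open>A\<close>, whose minimality leaves only equality.\<close>
    have "A1 \<subseteq> p ` K" unfolding A1_def kernel_def using kernel_q by auto
    then have *: "A1 = p ` K" using True A1 A(2) by (auto simp: plinth_pair_def)
    have "x \<in> N" if x: "x \<in> carrier X" "q x = \<one>\<^bsub>B\<^esub>" for x
    proof -
      have "p x \<in> A1" using x kernel_q * by auto
      then obtain n where n: "n \<in> N" "q n = \<one>\<^bsub>B\<^esub>" "p n = p x"
        by (auto simp: A1_def kernel_def)
      \<comment> \<open>\<open>x\<close> and \<open>n\<close> agree under both projections.\<close>
      then have "x \<otimes> inv n = \<one>" using x by (intro joint_inj) auto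
      then show "x \<in> N" using n x
        by (metis N.mem_carrier p.G.inv_closed p.G.inv_equality p.G.inv_inv)
    qed
    then show thesis by (rule kernel)
  next
    case False
    have "p ` N \<inter> p ` H = {\<one>\<^bsub>A\<^esub>}"
    proof (rule p.H.centraliser_mod_intransitive[OF A(1) A1 False, where K = "p ` K"])
      show "p ` K \<subseteq> carrier A" "p ` N \<subseteq> carrier A" by auto
      show "supplement A (p ` H) (p ` K)" using A(2) by (simp add: plinth_pair_def)
      show "\<one>\<^bsub>A\<^esub> \<in> p ` N" using p.hom_one N.one_closed by (metis imageI)
      fix y z assume "y \<in> p ` N" "z \<in> p ` K"
      \<comment> \<open>\<open>split\<close> provides a representative \<open>k\<close> of
        \<open>z\<close> with trivial \<open>q\<close>-image. The commutator \<open>c\<close> then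
        also has trivial \<open>q\<close>-image, and it lies in \<open>N\<close> by normality, so
        its \<open>p\<close>-image belongs to \<open>A1\<close>.\<close>
      then obtain n k where n: "n \<in> N" "y = p n" and k: "k \<in> K" "z = p k" "q k = \<one>\<^bsub>B\<^esub>"
        by clarify (metis split)
      define c where "c = inv k \<otimes> n \<otimes> k \<otimes> inv n"
      have "inv k \<otimes> n \<otimes> k \<in> N" using n k N.inv_op_closed1 by simp
      then have "c \<in> N" "q c = \<one>\<^bsub>B\<^esub>" "p c = inv\<^bsub>A\<^esub> z \<otimes>\<^bsub>A\<^esub> y \<otimes>\<^bsub>A\<^esub> z \<otimes>\<^bsub>A\<^esub> inv\<^bsub>A\<^esub> y"
        using n k by (auto simp: c_def)
      then show "inv\<^bsub>A\<^esub> z \<otimes>\<^bsub>A\<^esub> y \<otimes>\<^bsub>A\<^esub> z \<otimes>\<^bsub>A\<^esub> inv\<^bsub>A\<^esub> y \<in> A1"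
        unfolding A1_def kernel_def by (metis (mono_tags, lifting) IntI N.mem_carrier imageI mem_Collect_eq)
    qed
    then show thesis by (rule trivial)
  qed
qed

text \<open>If \<open>N\<close> contains the kernel of \<open>q\<close>, the alternative that holds
  for its image in \<open>B\<close> lifts to \<open>X\<close>. Otherwise \<open>N\<close> is already
  semiregular in \<open>A\<close>, and \<open>H_inter_trivial\<close> applies.\<close>

lemma semiprimitive_pair_subdirect: "semiprimitive_pair X H"
  unfolding semiprimitive_pair_def
proof (intro conjI allI impI)
  show "subgroup H X" by (rule H)
  fix N assume N: "N \<lhd> X"
  interpret N: normal N X by fact
  show "supplement X H N \<or> N \<inter> H = {\<one>}"
    using N
  proof (cases rule: normal_cases)
    case kernel
    have "supplement B (q ` H) (q ` N) \<or> q ` N \<inter> q ` H = {\<one>\<^bsub>B\<^esub>}"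
      using B(1) q.normal_image[OF N q_surj] unfolding semiprimitive_pair_def by blast
    then show ?thesis
    proof
      assume *: "supplement B (q ` H) (q ` N)"
      have "supplement X H N"
      proof (rule p.G.supplementI[OF N.subset H.subset])
        fix x assume x: "x \<in> carrier X"
        obtain n h where n: "n \<in> N" "h \<in> H" "q x = q n \<otimes>\<^bsub>B\<^esub> q h"
          using supplementD[OF *, of "q x"] q.hom_closed[OF x] by (metis imageE)
        \<comment> \<open>\<open>z\<close> measures the error of the lifted factorisation. It dies
          under \<open>q\<close>, hence lies in \<open>N\<close> and can be absorbed into the factor
          \<open>n\<close>.\<close>
        define z where "z = x \<otimes> inv (n \<otimes> h)"
        have z: "z \<in> carrier X" "q z = \<one>\<^bsub>B\<^esub>" using n x by (auto simp: z_def)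
        then have "z \<otimes> n \<in> N" using kernel n by simp
        moreover have "x = (z \<otimes> n) \<otimes> h" using n x by (simp add: z_def p.G.m_assoc)
        ultimately show "\<exists>n\<in>N. \<exists>h\<in>H. x = n \<otimes> h" using n by blast
      qed
      then show ?thesis ..
    next
      assume "q ` N \<inter> q ` H = {\<one>\<^bsub>B\<^esub>}"
      then show ?thesis using H_inter_trivial[OF N.subset N.one_closed] by blast
    qed
  next
    case trivial
    then show ?thesis using H_inter_trivial[OF N.subset N.one_closed] by blast
  qed
qed

text \<open>By minimality of the two given plinths, a normal supplement \<open>L\<close> below
  \<open>K\<close> has the same images as \<open>K\<close> in both factors. Either \<open>L\<close>
  contains the kernel of \<open>q\<close>, and equal \<open>q\<close>-images give equality; or equal
  \<open>p\<close>-images show that \<open>K\<close> meets \<open>H\<close> trivially, which leaves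
  no room between \<open>L\<close> and \<open>K\<close>.\<close>

lemma plinth_pair_subdirect: "plinth_pair X H K"
  unfolding plinth_pair_def
proof (intro conjI allI impI K)
  fix L assume "L \<lhd> X \<and> L \<subseteq> K \<and> supplement X H L"
  then have L: "L \<lhd> X" "L \<subseteq> K" "supplement X H L" by auto
  interpret L: normal L X by fact
  have "K \<subseteq> L"
    using L(1)
  proof (cases rule: normal_cases)
    case kernel
    have "q ` L = q ` K"
      using B(2) q.normal_image[OF L(1) q_surj] L(2)
        q.supplement_image[OF L(3) L.subset H.subset q_surj]
      by (meson image_mono plinth_pair_def)
    show ?thesis
    proof
      fix k assume k: "k \<in> K"
      then obtain l where l: "l \<in> L" "q k = q l" using \<open>q ` L = q ` K\<close> by (metis imageE imageI)
      then have "k \<otimes> inv l \<in> L" using k by (intro kernel) auto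
      then have "k \<otimes> inv l \<otimes> l \<in> L" using l by blast
      then show "k \<in> L" using k l by (simp add: p.G.m_assoc)
    qed
  next
    case trivial
    have "p ` L = p ` K"
      using A(2) p.normal_image[OF L(1) p_surj] L(2)
        p.supplement_image[OF L(3) L.subset H.subset p_surj]
      by (meson image_mono plinth_pair_def)
    \<comment> \<open>The hypothesis \<open>trivial\<close> concerns \<open>L\<close> only through
      its \<open>p\<close>-image, which is also that of \<open>K\<close>.\<close>
    then have KH: "K \<inter> H = {\<one>}"
      using trivial by (intro H_inter_trivial) auto
    show ?thesis
    proof
      fix k assume k: "k \<in> K"
      then obtain l h where l: "l \<in> L" "h \<in> H" "k = l \<otimes> h"
        using supplementD[OF L(3)] by (metis K.mem_carrier)
      \<comment> \<open>Dedekind's modular law in element form: as \<open>L\<close> lies in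
        \<open>K\<close>, the factor \<open>h\<close> lies in \<open>K \<inter> H\<close>.\<close>
      then have "h = inv l \<otimes> k" by (simp add: p.G.inv_cancel_left)
      then have "h \<in> K" using l(1) k L(2) by blast
      then have "h = \<one>" using l(2) KH by blast
      then show "k \<in> L" using l by simp
    qed
  qed
  then show "L = K" using L(2) by blast
qed

end

section \<open>Transitive permutation groups\<close>

lemma BijGroup_simps [simp]:
  "carrier (BijGroup S) = Bij S"
  "\<one>\<^bsub>BijGroup S\<^esub> = (\<lambda>x\<in>S. x)"
  by (simp_all add: BijGroup_def)

lemma group_perm_group: "subgroup G (BijGroup \<Omega>) \<Longrightarrow> group (perm_group \<Omega> G)"
  by (simp add: group_BijGroup subgroup.subgroup_is_group)

text \<open>The action by evaluation is an inclusion homomorphism into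
  \<open>BijGroup \<Omega>\<close>. Its image is \<open>G\<close>, so being an action already forces
  \<open>G\<close> to be a subgroup.\<close>

lemma transitive_iff:
  "transitive \<Omega> G \<longleftrightarrow> subgroup G (BijGroup \<Omega>) \<and> (\<forall>x\<in>\<Omega>. \<forall>y\<in>\<Omega>. \<exists>g\<in>G. g x = y)"
proof
  assume "transitive \<Omega> G"
  then interpret transitive_action "perm_group \<Omega> G" \<Omega> "\<lambda>g. g"
    by (simp add: transitive_def)
  have "subgroup G (BijGroup \<Omega>)"
    using group_hom.img_is_subgroup[OF group_hom] by simp
  then show "subgroup G (BijGroup \<Omega>) \<and> (\<forall>x\<in>\<Omega>. \<forall>y\<in>\<Omega>. \<exists>g\<in>G. g x = y)"
    using unique_orbit by simp
next
  assume *: "subgroup G (BijGroup \<Omega>) \<and> (\<forall>x\<in>\<Omega>. \<forall>y\<in>\<Omega>. \<exists>g\<in>G. g x = y)"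
  then have "group_hom (perm_group \<Omega> G) (BijGroup \<Omega>) (\<lambda>g. g)"
    using group.canonical_inj_is_hom[OF group_BijGroup, of G \<Omega>] by (simp add: id_def)
  with * show "transitive \<Omega> G"
    by (simp add: transitive_def transitive_action_def group_action_def transitive_action_axioms_def)
qed

lemma point_stabilizer_eq: "point_stabilizer \<Omega> G \<omega> = {g \<in> G. g \<omega> = \<omega>}"
  by (simp add: stabilizer_def)

locale transitive_perm_group =
  fixes \<Omega> :: "'a set" and G and \<omega>
  assumes transitive: "transitive \<Omega> G" and point: "\<omega> \<in> \<Omega>"
begin

abbreviation "P \<equiv> perm_group \<Omega> G"
abbreviation "S \<equiv> point_stabilizer \<Omega> G \<omega>"

lemma perm_subgroup: "subgroup G (BijGroup \<Omega>)"
  using transitive by (simp add: transitive_iff)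

lemma move: "\<lbrakk>x \<in> \<Omega>; y \<in> \<Omega>\<rbrakk> \<Longrightarrow> \<exists>g\<in>G. g x = y"
  using transitive by (simp add: transitive_iff)

sublocale group P by (rule group_perm_group[OF perm_subgroup])

sublocale act: group_action P \<Omega> "\<lambda>g. g"
  using transitive by (simp add: transitive_def transitive_action_def)

lemma in_Bij: "g \<in> G \<Longrightarrow> g \<in> Bij \<Omega>"
  using subgroup.mem_carrier[OF perm_subgroup] by simp

lemma apply_closed: "\<lbrakk>g \<in> G; x \<in> \<Omega>\<rbrakk> \<Longrightarrow> g x \<in> \<Omega>"
  using in_Bij Bij_imp_funcset by blast

lemma mult_apply: "\<lbrakk>g \<in> G; h \<in> G; x \<in> \<Omega>\<rbrakk> \<Longrightarrow> (g \<otimes>\<^bsub>BijGroup \<Omega>\<^esub> h) x = g (h x)"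
  using act.composition_rule by simp

lemma inv_apply: "\<lbrakk>g \<in> G; x \<in> \<Omega>; y \<in> \<Omega>\<rbrakk> \<Longrightarrow> (inv\<^bsub>P\<^esub> g) y = x \<longleftrightarrow> y = g x"
proof -
  assume g: "g \<in> G" and x: "x \<in> \<Omega>" and y: "y \<in> \<Omega>"
  then have "inv\<^bsub>P\<^esub> g \<in> G" "inv\<^bsub>P\<^esub> (inv\<^bsub>P\<^esub> g) = g"
    using inv_closed[of g] inv_inv[of g] by simp_all
  then show ?thesis
    using act.orbit_sym_aux[of g x y] act.orbit_sym_aux[of "inv\<^bsub>P\<^esub> g" y x] g x y
    by fastforce
qed

lemma eqI: "\<lbrakk>g \<in> G; h \<in> G; \<And>x. x \<in> \<Omega> \<Longrightarrow> g x = h x\<rbrakk> \<Longrightarrow> g = h"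
  using in_Bij Bij_imp_extensional extensionalityI by metis

lemma stabilizer: "subgroup S P"
  by (rule act.stabilizer_subgroup[OF point])

section \<open>Dictionary between permutation groups and pairs\<close>

lemma transitive_iff_supplement:
  assumes N: "N \<lhd> P"
  shows "transitive \<Omega> N \<longleftrightarrow> supplement P S N"
proof
  interpret N: normal N P by fact
  have NG: "N \<subseteq> G" using N.subset by simp
  {
    assume t: "transitive \<Omega> N"
    show "supplement P S N"
    proof (rule supplementI)
      fix g assume "g \<in> carrier P"
      then have g: "g \<in> G" by simp
      then obtain n where n: "n \<in> N" "n \<omega> = g \<omega>"
        using t apply_closed point by (metis transitive_iff)
      then have nG: "n \<in> G" using NG by blast
      \<comment> \<open>Frattini argument: \<open>n\<close> and \<open>g\<close> agree at
        \<open>\<omega>\<close>, so \<open>h\<close> fixes it.\<close>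
      define h where "h = inv\<^bsub>P\<^esub> n \<otimes>\<^bsub>P\<^esub> g"
      have "h \<in> G" using inv_closed[of n] m_closed nG g by (simp add: h_def)
      moreover have "h \<omega> = \<omega>"
        unfolding h_def using nG g n inv_closed[of n] point apply_closed
        by (simp add: mult_apply inv_apply)
      moreover have "g = n \<otimes>\<^bsub>P\<^esub> h"
        unfolding h_def using nG g inv_cancel_left[of n g] by simp
      ultimately show "\<exists>n\<in>N. \<exists>h\<in>S. g = n \<otimes>\<^bsub>P\<^esub> h"
        using n by (auto simp: point_stabilizer_eq)
    qed (use NG in \<open>auto simp: point_stabilizer_eq\<close>)
  next
    assume s: "supplement P S N"
    have *: "\<exists>n\<in>N. n \<omega> = x" if x: "x \<in> \<Omega>" for x
    proof -
      obtain g where g: "g \<in> G" "g \<omega> = x" using move[OF point x] by blast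
      then have "g \<in> carrier P" by simp
      with s obtain n h where "n \<in> N" "h \<in> S" "g = n \<otimes>\<^bsub>P\<^esub> h" by (rule supplementD)
      then have "n \<in> G" "h \<in> G" "h \<omega> = \<omega>" "g = n \<otimes>\<^bsub>BijGroup \<Omega>\<^esub> h"
        using NG by (auto simp: point_stabilizer_eq)
      then have "n \<omega> = x" using g(2) point mult_apply by simp
      then show ?thesis using \<open>n \<in> N\<close> by blast
    qed
    have "\<exists>g\<in>N. g x = y" if xy: "x \<in> \<Omega>" "y \<in> \<Omega>" for x y
    proof -
      \<comment> \<open>The element carrying \<open>x\<close> to \<open>y\<close> passes through the
        base point: first the inverse of \<open>n\<close>, then \<open>m\<close>.\<close>
      obtain n m where nm: "n \<in> N" "n \<omega> = x" "m \<in> N" "m \<omega> = y" using * xy by metis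
      then have "n \<in> G" "m \<in> G" using NG by blast+
      then have "(m \<otimes>\<^bsub>P\<^esub> inv\<^bsub>P\<^esub> n) x = y"
        using xy point nm inv_closed[of n] inv_apply[of n \<omega> x] by (simp add: mult_apply)
      then show ?thesis using nm by (metis N.m_closed N.m_inv_closed)
    qed
    moreover have "subgroup N (BijGroup \<Omega>)"
      using group.incl_subgroup[OF group_BijGroup perm_subgroup N.is_subgroup] .
    ultimately show "transitive \<Omega> N" by (simp add: transitive_iff)
  }
qed

lemma semiregular_iff_trivial:
  assumes N: "N \<lhd> P"
  shows "semiregular \<Omega> N \<longleftrightarrow> N \<inter> S = {\<one>\<^bsub>P\<^esub>}"
proof
  interpret N: normal N P by fact
  have NG: "N \<subseteq> G" using N.subset by simp
  {
    assume "semiregular \<Omega> N"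
    then show "N \<inter> S = {\<one>\<^bsub>P\<^esub>}"
      using point NG by (auto simp: semiregular_def point_stabilizer_eq)
  next
    assume t: "N \<inter> S = {\<one>\<^bsub>P\<^esub>}"
    have "n = \<one>\<^bsub>P\<^esub>" if x: "x \<in> \<Omega>" and n: "n \<in> N" "n x = x" for x n
    proof -
      obtain g where g: "g \<in> G" "g \<omega> = x" using move[OF point x] by blast
      have nG: "n \<in> G" using n NG by blast
      \<comment> \<open>Conjugation by \<open>g\<close> brings the fixed point \<open>x\<close> back
        to \<open>\<omega>\<close>, and normality keeps the element in \<open>N\<close>. One trivial
        stabiliser thus gives all of them.\<close>
      define m where "m = inv\<^bsub>P\<^esub> g \<otimes>\<^bsub>P\<^esub> n \<otimes>\<^bsub>P\<^esub> g"
      have "m \<in> N" unfolding m_def using g n N.inv_op_closed1 by simp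
      moreover have "m \<omega> = \<omega>"
        using g nG n x point inv_closed[of g] m_closed[of "inv\<^bsub>P\<^esub> g" n]
        by (simp add: m_def mult_apply inv_apply)
      ultimately have "m = \<one>\<^bsub>P\<^esub>" using t NG by (auto simp: point_stabilizer_eq)
      then show ?thesis
        using conjugate_eq_oneD[of g n] g nG by (simp add: m_def)
    qed
    note fixed = this
    have "point_stabilizer \<Omega> N x = {\<one>\<^bsub>P\<^esub>}" if x: "x \<in> \<Omega>" for x
    proof (intro equalityI subsetI)
      fix n assume "n \<in> point_stabilizer \<Omega> N x"
      then have "n = \<one>\<^bsub>P\<^esub>" by (intro fixed[OF x]) (simp_all add: point_stabilizer_eq)
      then show "n \<in> {\<one>\<^bsub>P\<^esub>}" by (rule ssubst) (rule singletonI)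
    next
      fix n assume "n \<in> {\<one>\<^bsub>P\<^esub>}"
      then show "n \<in> point_stabilizer \<Omega> N x"
        using x N.one_closed by (simp add: point_stabilizer_eq)
    qed
    then show "semiregular \<Omega> N" by (simp add: semiregular_def)
  }
qed

lemma semiprimitive_iff_pair: "semiprimitive \<Omega> G \<longleftrightarrow> semiprimitive_pair P S"
  unfolding semiprimitive_def semiprimitive_pair_def
  using transitive perm_subgroup stabilizer transitive_iff_supplement semiregular_iff_trivial
  by blast

lemma plinth_iff_pair: "plinth \<Omega> G K \<longleftrightarrow> plinth_pair P S K"
  unfolding plinth_def plinth_pair_def
  using transitive_iff_supplement by (metis psubset_eq)

end

section \<open>Actions on cosets and quotient actions\<close>

lemma (in group) l_coset_eq_iff:
  assumes "subgroup H G" "a \<in> carrier G" "b \<in> carrier G"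
  shows "a <# H = b <# H \<longleftrightarrow> inv a \<otimes> b \<in> H"
proof
  assume "a <# H = b <# H"
  then have "b \<in> a <# H" using lcos_self assms by metis
  then show "inv a \<otimes> b \<in> H" using subgroup.lcos_module_imp assms group_axioms by metis
next
  assume "inv a \<otimes> b \<in> H"
  then have "b \<in> a <# H" using subgroup.lcos_module_rev assms group_axioms by metis
  then show "a <# H = b <# H" using l_repr_independence assms by metis
qed

text \<open>The restriction fixes the value outside the coset space, since elements of
  \<open>Bij\<close> must be extensional.\<close>

definition coset_act :: "('a, 'm) monoid_scheme \<Rightarrow> 'a set \<Rightarrow> 'a \<Rightarrow> 'a set \<Rightarrow> 'a set"
  where "coset_act X H g = (\<lambda>C \<in> lcosets\<^bsub>X\<^esub> H. g <#\<^bsub>X\<^esub> C)"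

text \<open>The condition says that the normal core of \<open>H\<close> is trivial, which is
  faithfulness of the action on left cosets.\<close>

locale core_free_subgroup = group X + subgroup H X for X (structure) and H +
  assumes core_free: "\<lbrakk>x \<in> H; \<And>g. g \<in> carrier X \<Longrightarrow> inv g \<otimes> x \<otimes> g \<in> H\<rbrakk> \<Longrightarrow> x = \<one>"
begin

abbreviation "cosets \<equiv> lcosets H"
abbreviation "act \<equiv> coset_act X H"

lemma cosets_iff: "C \<in> cosets \<longleftrightarrow> (\<exists>g\<in>carrier X. C = g <# H)"
  by (auto simp: LCOSETS_def)

lemma act_coset:
  "\<lbrakk>g \<in> carrier X; x \<in> carrier X\<rbrakk> \<Longrightarrow> act g (x <# H) = (g \<otimes> x) <# H"
  unfolding coset_act_def using cosets_iff lcos_m_assoc subset by auto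

lemma base: "H \<in> cosets"
  unfolding cosets_iff by (rule bexI[of _ \<one>]) (simp_all add: lcos_mult_one subset)

lemma act_Bij:
  assumes "g \<in> carrier X"
  shows "act g \<in> Bij cosets"
proof -
  have *: "act (inv h) (act h C) = C" "act h C \<in> cosets"
    if "h \<in> carrier X" "C \<in> cosets" for h C
    using that act_coset by (auto simp: cosets_iff inv_cancel_left)
  have "bij_betw (act g) cosets cosets"
    using *[of g] *[of "inv g"] assms by (intro bij_betw_byWitness[where f' = "act (inv g)"]) auto
  then show ?thesis by (simp add: Bij_def coset_act_def)
qed

lemma act_mult:
  assumes "g \<in> carrier X" "h \<in> carrier X"
  shows "act (g \<otimes> h) = act g \<otimes>\<^bsub>BijGroup cosets\<^esub> act h"
proof -
  have "act (g \<otimes> h) C = compose cosets (act g) (act h) C" for C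
  proof (cases "C \<in> cosets")
    case True
    then show ?thesis using assms act_coset by (auto simp: cosets_iff compose_def m_assoc)
  qed (simp add: coset_act_def compose_def)
  then show ?thesis using assms act_Bij by (simp add: BijGroup_def fun_eq_iff)
qed

lemma act_group_hom: "group_hom X (BijGroup cosets) act"
  using act_Bij act_mult
  by (simp add: group_hom_def group_hom_axioms_def group_BijGroup group_axioms hom_def Pi_def)

lemma act_inj: "inj_on act (carrier X)"
proof (rule inj_onI)
  fix g h assume gh: "g \<in> carrier X" "h \<in> carrier X" "act g = act h"
  have *: "inv x \<otimes> (inv g \<otimes> h) \<otimes> x \<in> H" if "x \<in> carrier X" for x
  proof -
    have "(g \<otimes> x) <# H = (h \<otimes> x) <# H" using gh that act_coset by metis
    then have "inv (g \<otimes> x) \<otimes> (h \<otimes> x) \<in> H" using l_coset_eq_iff gh that subgroup_axioms by simp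
    then show ?thesis using gh that by (simp add: inv_mult_group m_assoc)
  qed
  \<comment> \<open>Every conjugate of \<open>inv g \<otimes> h\<close> lies in \<open>H\<close>;
    the instance at \<open>\<one>\<close> gives the element itself.\<close>
  have "inv g \<otimes> h = \<one>"
    using *[of \<one>] gh by (intro core_free *) auto
  then show "g = h" using gh by (metis inv_closed inv_equality inv_inv)
qed

lemma act_iso: "act \<in> iso X (perm_group cosets (act ` carrier X))"
  using act_inj act_mult by (auto simp: iso_def hom_def bij_betw_def)

lemma act_transitive: "transitive cosets (act ` carrier X)"
proof -
  have "\<exists>g\<in>act ` carrier X. g C = D" if CD: "C \<in> cosets" "D \<in> cosets" for C D
  proof -
    obtain x y where xy: "x \<in> carrier X" "C = x <# H" "y \<in> carrier X" "D = y <# H"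
      using CD cosets_iff by metis
    then have "act (y \<otimes> inv x) C = D" by (simp add: act_coset m_assoc)
    then show ?thesis using xy by blast
  qed
  then show ?thesis
    using group_hom.img_is_subgroup[OF act_group_hom] by (simp add: transitive_iff)
qed

lemma act_stabilizer:
  assumes "x \<in> carrier X"
  shows "point_stabilizer cosets (act ` carrier X) (x <# H) = (\<lambda>h. act (x \<otimes> h \<otimes> inv x)) ` H"
proof (intro equalityI subsetI)
  fix f assume "f \<in> point_stabilizer cosets (act ` carrier X) (x <# H)"
  then obtain g where g: "g \<in> carrier X" "f = act g" "(g \<otimes> x) <# H = x <# H"
    using assms act_coset by (auto simp: point_stabilizer_eq)
  then have "inv x \<otimes> (g \<otimes> x) \<in> H"
    using l_coset_eq_iff[OF subgroup_axioms, of x "g \<otimes> x"] assms by auto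
  moreover have "x \<otimes> (inv x \<otimes> (g \<otimes> x)) \<otimes> inv x = g"
    using g assms by (simp add: m_assoc inv_cancel_left)
  ultimately show "f \<in> (\<lambda>h. act (x \<otimes> h \<otimes> inv x)) ` H" using g by force
next
  fix f assume "f \<in> (\<lambda>h. act (x \<otimes> h \<otimes> inv x)) ` H"
  then obtain h where h: "h \<in> H" "f = act (x \<otimes> h \<otimes> inv x)" by blast
  have "(x \<otimes> h) <# H = x <# H"
    using l_coset_eq_iff[OF subgroup_axioms, of x "x \<otimes> h"] assms h by (auto simp: inv_cancel_left)
  then have "f (x <# H) = x <# H" using h assms by (simp add: act_coset m_assoc)
  then show "f \<in> point_stabilizer cosets (act ` carrier X) (x <# H)"
    using h assms by (auto simp: point_stabilizer_eq)
qed

lemma act_stabilizer_base: "point_stabilizer cosets (act ` carrier X) H = act ` H"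
  using act_stabilizer[of \<one>] lcos_mult_one[OF subset] by simp

lemma act_stabilizer_iso:
  assumes "C \<in> cosets"
  shows "perm_group cosets (point_stabilizer cosets (act ` carrier X) C) \<cong> X\<lparr>carrier := H\<rparr>"
proof -
  obtain x where x: "x \<in> carrier X" "C = x <# H" using assms cosets_iff by blast
  \<comment> \<open>Conjugation by \<open>x\<close> followed by the faithful action maps
    \<open>H\<close> onto the stabiliser of an arbitrary point, not only of the base point.\<close>
  let ?\<theta> = "\<lambda>h. act (x \<otimes> h \<otimes> inv x)"
  have "inj_on ?\<theta> H"
  proof (rule inj_onI)
    fix h h' assume h: "h \<in> H" "h' \<in> H" "?\<theta> h = ?\<theta> h'"
    then have "x \<otimes> h \<otimes> inv x = x \<otimes> h' \<otimes> inv x" using act_inj x by (simp add: inj_on_eq_iff)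
    then show "h = h'" using x h by simp
  qed
  moreover have "?\<theta> (h \<otimes> h') = ?\<theta> h \<otimes>\<^bsub>BijGroup cosets\<^esub> ?\<theta> h'" if "h \<in> H" "h' \<in> H" for h h'
    using that x by (simp add: m_assoc inv_cancel_left flip: act_mult)
  ultimately have "?\<theta> \<in> iso (X\<lparr>carrier := H\<rparr>)
      (perm_group cosets (point_stabilizer cosets (act ` carrier X) C))"
    unfolding x(2) act_stabilizer[OF x(1)] by (auto simp: iso_def hom_def bij_betw_def)
  then show ?thesis
    using group.iso_sym[OF subgroup_is_group[OF group_axioms]] by (auto simp: is_iso_def)
qed

end

section \<open>Recognising quotient actions\<close>

text \<open>The witnessing normal subgroup is the image of the kernel of \<open>\<pi>\<close>. An
  equivariant surjection \<open>f\<close> on whose fibres this kernel is transitive identifies the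
  orbits of the kernel with the points of \<open>\<Delta>\<close>.\<close>

lemma is_quotient_action_ofI:
  assumes X: "group X" and act: "act \<in> iso X (perm_group \<Omega> G)"
    and G: "subgroup G (BijGroup \<Omega>)" and \<Delta>: "subgroup D (BijGroup \<Delta>)"
    and \<pi>: "\<pi> \<in> hom X (perm_group \<Delta> D)" "\<pi> ` carrier X = D"
    and f: "f ` \<Omega> = \<Delta>"
    and equivariant: "\<And>g x. \<lbrakk>g \<in> carrier X; x \<in> \<Omega>\<rbrakk> \<Longrightarrow> f (act g x) = \<pi> g (f x)"
    and fibre: "\<And>x y. \<lbrakk>x \<in> \<Omega>; y \<in> \<Omega>; f x = f y\<rbrakk> \<Longrightarrow>
      \<exists>g\<in>carrier X. \<pi> g = \<one>\<^bsub>BijGroup \<Delta>\<^esub> \<and> act g x = y"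
  shows "is_quotient_action_of \<Delta> D \<Omega> G"
proof -
  interpret X: group X by fact
  interpret G: group "perm_group \<Omega> G" by (rule group_perm_group[OF G])
  interpret D: group "perm_group \<Delta> D" by (rule group_perm_group[OF \<Delta>])
  interpret \<pi>: group_hom X "perm_group \<Delta> D" \<pi> by unfold_locales (rule \<pi>(1))
  interpret act: group_hom X "perm_group \<Omega> G" act
    using act by unfold_locales (simp add: iso_def)
  have act_surj: "act ` carrier X = G" using act by (simp add: iso_iff)
  define N where "N = act ` kernel X (perm_group \<Delta> D) \<pi>"
  have N: "N \<lhd> perm_group \<Omega> G"
    unfolding N_def using act_surj by (intro act.normal_image \<pi>.normal_kernel) simp
  define \<beta> where "\<beta> y = {x \<in> \<Omega>. f x = y}" for y
  have act_Bij: "act g \<in> Bij \<Omega>" if "g \<in> carrier X" for g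
    using that act_surj subgroup.mem_carrier[OF G] by auto
  have act_closed: "act g x \<in> \<Omega>" if "g \<in> carrier X" "x \<in> \<Omega>" for g x
    using act_Bij[OF that(1)] that(2) Bij_imp_funcset by blast
  have D_Bij: "h \<in> Bij \<Delta>" if "h \<in> D" for h
    using that subgroup.mem_carrier[OF \<Delta>] by auto
  have D_closed: "h y \<in> \<Delta>" if "h \<in> D" "y \<in> \<Delta>" for h y
    using D_Bij[OF that(1)] that(2) Bij_imp_funcset by blast
  \<comment> \<open>Equivariance keeps the kernel inside the fibres of \<open>f\<close>, and
    \<open>fibre\<close> makes it transitive on each. Hence \<open>\<beta>\<close> will be the
    bijection from \<open>\<Delta>\<close> onto the set of orbits.\<close>
  have orbit: "orbit (perm_group \<Omega> N) (\<lambda>g. g) x = \<beta> (f x)" if x: "x \<in> \<Omega>" for x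
  proof (intro equalityI subsetI)
    fix y assume "y \<in> orbit (perm_group \<Omega> N) (\<lambda>g. g) x"
    then obtain g where g: "g \<in> carrier X" "\<pi> g = \<one>\<^bsub>BijGroup \<Delta>\<^esub>" "y = act g x"
      by (auto simp: orbit_def N_def kernel_def)
    then have "f y = f x" using equivariant x f by auto
    then show "y \<in> \<beta> (f x)" using g x act_closed by (simp add: \<beta>_def)
  next
    fix y assume "y \<in> \<beta> (f x)"
    then obtain g where "g \<in> carrier X" "\<pi> g = \<one>\<^bsub>BijGroup \<Delta>\<^esub>" "act g x = y"
      using fibre[OF x, of y] by (auto simp: \<beta>_def)
    then show "y \<in> orbit (perm_group \<Omega> N) (\<lambda>g. g) x"
      by (auto simp: orbit_def N_def kernel_def)
  qed
  define Q where "Q = orbit_set \<Omega> N"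
  have "Q = (\<lambda>x. \<beta> (f x)) ` \<Omega>" using orbit by (auto simp: Q_def orbits_def)
  then have Q: "Q = \<beta> ` \<Delta>" unfolding f[symmetric] by (simp add: image_image)
  have \<beta>_inj: "inj_on \<beta> \<Delta>"
    unfolding f[symmetric] by (rule inj_onI) (auto simp: \<beta>_def)
  define \<beta>' where "\<beta>' = inv_into \<Delta> \<beta>"
  have \<beta>'_\<beta>: "\<beta>' (\<beta> y) = y" if "y \<in> \<Delta>" for y
    using that \<beta>_inj by (simp add: \<beta>'_def)
  \<comment> \<open>Conjugation by the bijection \<open>\<beta>\<close>, restricted so that the
    values lie in \<open>Bij Q\<close>.\<close>
  define \<psi> where "\<psi> h = (\<lambda>B\<in>Q. \<beta> (h (\<beta>' B)))" for h
  have \<psi>_\<beta>: "\<psi> h (\<beta> y) = \<beta> (h y)" if "y \<in> \<Delta>" for h y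
    using that by (simp add: \<psi>_def Q \<beta>'_\<beta>)
  have act_image: "act g ` \<beta> y = \<beta> (\<pi> g y)" if g: "g \<in> carrier X" and y: "y \<in> \<Delta>" for g y
  proof (intro equalityI subsetI)
    fix x assume "x \<in> act g ` \<beta> y"
    then show "x \<in> \<beta> (\<pi> g y)" using g act_closed equivariant by (auto simp: \<beta>_def)
  next
    fix x assume x: "x \<in> \<beta> (\<pi> g y)"
    then have "x \<in> act g ` \<Omega>" using act_Bij[OF g] by (auto simp: Bij_def bij_betw_def \<beta>_def)
    then obtain z where z: "z \<in> \<Omega>" "x = act g z" by blast
    then have "\<pi> g (f z) = \<pi> g y" using x g equivariant by (simp add: \<beta>_def)
    moreover have "inj_on (\<pi> g) \<Delta>" using D_Bij g \<pi>(2) by (auto simp: Bij_def bij_betw_def)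
    ultimately have "f z = y" using z y f by (auto dest: inj_onD)
    then show "x \<in> act g ` \<beta> y" using z by (auto simp: \<beta>_def)
  qed
  \<comment> \<open>Transporting \<open>\<pi> g\<close> along \<open>\<beta>\<close> is the same as
    letting \<open>act g\<close> move whole orbits. As \<open>\<pi>\<close> is onto
    \<open>D\<close>, the image of \<open>D\<close> under \<open>\<psi>\<close> is the quotient
    action.\<close>
  have \<psi>_\<pi>: "\<psi> (\<pi> g) = (\<lambda>B\<in>Q. act g ` B)" if "g \<in> carrier X" for g
    unfolding \<psi>_def
  proof (rule restrict_ext)
    fix B assume "B \<in> Q"
    then obtain y where "y \<in> \<Delta>" "B = \<beta> y" using Q by blast
    then show "\<beta> (\<pi> g (\<beta>' B)) = act g ` B" using that by (simp add: \<beta>'_\<beta> act_image)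
  qed
  have "quotient_action \<Omega> G N = (\<lambda>g. \<psi> (\<pi> g)) ` carrier X"
    unfolding quotient_action_def act_surj[symmetric] image_image Q_def[symmetric]
    using \<psi>_\<pi> by (intro image_cong) auto
  then have quot: "quotient_action \<Omega> G N = \<psi> ` D"
    unfolding \<pi>(2)[symmetric] by (simp add: image_image)
  have \<psi>_Bij: "\<psi> h \<in> Bij Q" if h: "h \<in> D" for h
  proof -
    have "bij_betw \<beta> \<Delta> Q" using \<beta>_inj by (simp add: Q bij_betw_def)
    then have "bij_betw (\<beta> \<circ> h \<circ> \<beta>') Q Q"
      unfolding \<beta>'_def using D_Bij[OF h]
      by (auto simp: Bij_def intro!: bij_betw_trans bij_betw_inv_into)
    then have "bij_betw (\<psi> h) Q Q"
      by (rule bij_betw_cong[THEN iffD1, rotated]) (simp add: \<psi>_def)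
    then show ?thesis by (simp add: Bij_def \<psi>_def)
  qed
  have \<psi>_mult: "\<psi> (h \<otimes>\<^bsub>BijGroup \<Delta>\<^esub> k) = \<psi> h \<otimes>\<^bsub>BijGroup Q\<^esub> \<psi> k" if hk: "h \<in> D" "k \<in> D" for h k
  proof -
    have "\<psi> (compose \<Delta> h k) B = compose Q (\<psi> h) (\<psi> k) B" for B
    proof (cases "B \<in> Q")
      case True
      then obtain y where "y \<in> \<Delta>" "B = \<beta> y" using Q by blast
      then show ?thesis using hk True D_closed by (simp add: \<psi>_\<beta> compose_def)
    qed (simp add: \<psi>_def compose_def)
    then show ?thesis using hk D_Bij \<psi>_Bij by (simp add: BijGroup_def fun_eq_iff)
  qed
  have \<psi>_inj: "inj_on \<psi> D"
  proof (rule inj_onI)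
    fix h k assume hk: "h \<in> D" "k \<in> D" "\<psi> h = \<psi> k"
    show "h = k"
    proof (rule extensionalityI)
      show "h \<in> extensional \<Delta>" "k \<in> extensional \<Delta>"
        using hk D_Bij Bij_imp_extensional by blast+
      fix y assume y: "y \<in> \<Delta>"
      then have "\<beta> (h y) = \<beta> (k y)" using hk(3) \<psi>_\<beta> by metis
      then show "h y = k y" using y hk D_closed \<beta>_inj by (auto dest: inj_onD)
    qed
  qed
  have "\<psi> \<in> iso (perm_group \<Delta> D) (perm_group Q (quotient_action \<Omega> G N))"
    unfolding quot using \<psi>_mult \<psi>_inj by (auto simp: iso_def hom_def bij_betw_def)
  moreover have "bij_betw \<beta> \<Delta> Q" using \<beta>_inj by (simp add: Q bij_betw_def)
  ultimately have "permutationally_isomorphic \<Delta> D (orbit_set \<Omega> N) (quotient_action \<Omega> G N)"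
    unfolding permutationally_isomorphic_def Q_def[symmetric] using \<psi>_\<beta> by metis
  with N show ?thesis unfolding is_quotient_action_of_def by blast
qed

lemma (in group_hom) mult_inv_in_kernel:
  "\<lbrakk>x \<in> carrier G; y \<in> carrier G; h x = h y\<rbrakk> \<Longrightarrow> x \<otimes> inv y \<in> kernel G H h"
  by (simp add: kernel_def)

context core_free_subgroup
begin

text \<open>The image of \<open>H\<close> is the stabiliser of \<open>\<delta>\<close>, so sending
  the coset of \<open>x\<close> to \<open>\<pi> x \<delta>\<close> is a well-defined equivariant
  surjection to which the preceding criterion applies.\<close>

lemma coset_action_quotient:
  assumes D: "transitive_perm_group \<Delta> D \<delta>"
    and \<pi>: "\<pi> \<in> hom X (perm_group \<Delta> D)" "\<pi> ` carrier X = D" "\<pi> ` H = point_stabilizer \<Delta> D \<delta>"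
  shows "is_quotient_action_of \<Delta> D cosets (act ` carrier X)"
proof -
  interpret D: transitive_perm_group \<Delta> D \<delta> by fact
  interpret \<pi>: group_hom X "perm_group \<Delta> D" \<pi> by unfold_locales (rule \<pi>(1))
  have \<pi>D: "\<pi> g \<in> D" if "g \<in> carrier X" for g using that \<pi>(2) by blast
  have \<pi>_mult: "\<pi> (g \<otimes> h) y = \<pi> g (\<pi> h y)" if "g \<in> carrier X" "h \<in> carrier X" "y \<in> \<Delta>" for g h y
    using that \<pi>D by (simp add: D.mult_apply)
  have \<pi>H: "\<pi> h \<delta> = \<delta>" if "h \<in> H" for h
  proof -
    have "\<pi> h \<in> point_stabilizer \<Delta> D \<delta>" using that \<pi>(3) by blast
    then show ?thesis by (simp add: point_stabilizer_eq)
  qed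
  \<comment> \<open>The choice of representative is harmless: two of them differ by an element of
    \<open>H\<close>, whose image fixes \<open>\<delta>\<close>.\<close>
  define f where "f C = \<pi> (SOME g. g \<in> C) \<delta>" for C
  have f: "f (x <# H) = \<pi> x \<delta>" if x: "x \<in> carrier X" for x
  proof -
    have "(SOME g. g \<in> x <# H) \<in> x <# H"
      using lcos_self[OF x subgroup_axioms] by (rule someI)
    then obtain h where "h \<in> H" "(SOME g. g \<in> x <# H) = x \<otimes> h" by (auto simp: l_coset_def)
    then show ?thesis using x \<pi>H D.point by (simp add: f_def \<pi>_mult del: \<pi>.hom_mult)
  qed
  show ?thesis
  proof (rule is_quotient_action_ofI[OF group_axioms act_iso _ D.perm_subgroup \<pi>(1,2), where f = f])
    show "subgroup (act ` carrier X) (BijGroup cosets)"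
      using group_hom.img_is_subgroup[OF act_group_hom] .
    show "f ` cosets = \<Delta>"
    proof (intro equalityI subsetI)
      fix y assume "y \<in> f ` cosets"
      then show "y \<in> \<Delta>" using f \<pi>D D.point D.apply_closed by (auto simp: cosets_iff)
    next
      fix y assume "y \<in> \<Delta>"
      then obtain d where "d \<in> D" "d \<delta> = y" using D.move[OF D.point] by blast
      then obtain x where "x \<in> carrier X" "\<pi> x \<delta> = y" using \<pi>(2) by blast
      then show "y \<in> f ` cosets" using f cosets_iff by (metis imageI)
    qed
    fix g C assume g: "g \<in> carrier X" and "C \<in> cosets"
    then obtain x where "x \<in> carrier X" "C = x <# H" using cosets_iff by blast
    then show "f (act g C) = \<pi> g (f C)"
      using g D.point by (simp add: act_coset f \<pi>_mult del: \<pi>.hom_mult)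
  next
    fix C C' assume "C \<in> cosets" "C' \<in> cosets" and eq: "f C = f C'"
    then obtain x y where x: "x \<in> carrier X" "C = x <# H" and y: "y \<in> carrier X" "C' = y <# H"
      using cosets_iff by metis
    have "\<pi> (inv x \<otimes> y) \<delta> = \<delta>"
    proof -
      have "\<pi> (inv x \<otimes> y) \<delta> = \<pi> (inv x) (\<pi> x \<delta>)"
        using eq x y D.point by (simp add: f \<pi>_mult del: \<pi>.hom_mult \<pi>.hom_inv)
      also have "\<dots> = \<pi> (inv x \<otimes> x) \<delta>"
        using x D.point by (subst \<pi>_mult) simp_all
      also have "\<dots> = \<delta>" using x D.point by simp
      finally show ?thesis .
    qed
    then have "\<pi> (inv x \<otimes> y) \<in> \<pi> ` H"
      using x y \<pi>D[of "inv x \<otimes> y"] \<pi>(3) by (simp add: point_stabilizer_eq del: \<pi>.hom_mult \<pi>.hom_inv)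
    then obtain h where h: "h \<in> H" "\<pi> (inv x \<otimes> y) = \<pi> h" by blast
    \<comment> \<open>The factor \<open>inv h\<close> corrects \<open>inv x \<otimes> y\<close> to
      an element of the kernel. Its conjugate \<open>g\<close> satisfies
      \<open>g \<otimes> x \<otimes> h = y\<close>, so it carries the coset of \<open>x\<close> to
      that of \<open>y\<close>.\<close>
    define n where "n = inv x \<otimes> y \<otimes> inv h"
    define g where "g = x \<otimes> n \<otimes> inv x"
    have "n \<in> kernel X (perm_group \<Delta> D) \<pi>"
      unfolding n_def using \<pi>.mult_inv_in_kernel h x y by simp
    then have "g \<in> kernel X (perm_group \<Delta> D) \<pi>"
      unfolding g_def using normal.inv_op_closed2[OF \<pi>.normal_kernel] x by blast
    then have g: "g \<in> carrier X" and "\<pi> g = \<one>\<^bsub>BijGroup \<Delta>\<^esub>" by (simp_all add: kernel_def)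
    moreover have "act g C = C'"
    proof -
      have "(g \<otimes> x) \<otimes> h = y"
        using x y h by (simp add: g_def n_def m_assoc inv_cancel_left)
      then have "inv (g \<otimes> x) \<otimes> y = h" using x g h inv_cancel_left(2)[of "g \<otimes> x" h] by simp
      then show ?thesis
        using x y g h l_coset_eq_iff[OF subgroup_axioms, of "g \<otimes> x" y] by (simp add: act_coset)
    qed
    ultimately show "\<exists>g\<in>carrier X. \<pi> g = \<one>\<^bsub>BijGroup \<Delta>\<^esub> \<and> act g C = C'" using g by blast
  qed
qed

end

section \<open>Amalgamation along isomorphic point stabilisers\<close>

locale stabilizer_matching =
  A: group A + B: group B
  for A :: "('y, 'k) monoid_scheme" and B :: "('z, 'l) monoid_scheme" +
  fixes S\<^sub>1 S\<^sub>2 K\<^sub>1 K\<^sub>2 \<mu>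
  assumes A: "semiprimitive_pair A S\<^sub>1" "plinth_pair A S\<^sub>1 K\<^sub>1"
    and B: "semiprimitive_pair B S\<^sub>2" "plinth_pair B S\<^sub>2 K\<^sub>2"
    and \<mu>: "\<mu> \<in> iso (A\<lparr>carrier := S\<^sub>1\<rparr>) (B\<lparr>carrier := S\<^sub>2\<rparr>)"
    and \<mu>_K: "\<mu> ` (K\<^sub>1 \<inter> S\<^sub>1) = K\<^sub>2 \<inter> S\<^sub>2"
begin

sublocale S\<^sub>1: subgroup S\<^sub>1 A using A by (simp add: semiprimitive_pair_def)
sublocale S\<^sub>2: subgroup S\<^sub>2 B using B by (simp add: semiprimitive_pair_def)
sublocale K\<^sub>1: normal K\<^sub>1 A using A by (simp add: plinth_pair_def)
sublocale K\<^sub>2: normal K\<^sub>2 B using B by (simp add: plinth_pair_def)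
sublocale AB: group "A \<times>\<times> B" by (rule DirProd_group[OF A.group_axioms B.group_axioms])

definition "S = (\<lambda>h. (h, \<mu> h)) ` S\<^sub>1"
definition "K = K\<^sub>1 \<times> K\<^sub>2"
definition "X = (A \<times>\<times> B)\<lparr>carrier := K <#>\<^bsub>A \<times>\<times> B\<^esub> S\<rparr>"

lemma \<mu>_mem: "h \<in> S\<^sub>1 \<Longrightarrow> \<mu> h \<in> S\<^sub>2"
  using \<mu> by (auto simp: iso_def hom_def)

lemma \<mu>_mult: "\<lbrakk>h \<in> S\<^sub>1; h' \<in> S\<^sub>1\<rbrakk> \<Longrightarrow> \<mu> (h \<otimes>\<^bsub>A\<^esub> h') = \<mu> h \<otimes>\<^bsub>B\<^esub> \<mu> h'"
  using \<mu> by (auto simp: iso_def hom_def)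

lemma \<mu>_inj: "inj_on \<mu> S\<^sub>1"
  using \<mu> by (simp add: iso_def bij_betw_def)

lemma \<mu>_image: "\<mu> ` S\<^sub>1 = S\<^sub>2"
  using \<mu> by (simp add: iso_def bij_betw_def)

lemma \<mu>_group_hom: "group_hom (A\<lparr>carrier := S\<^sub>1\<rparr>) (A \<times>\<times> B) (\<lambda>h. (h, \<mu> h))"
  using S\<^sub>1.subgroup_is_group[OF A.group_axioms] AB.group_axioms \<mu>_mult \<mu>_mem
  by (auto simp: group_hom_def group_hom_axioms_def hom_def)

lemma S_subgroup: "subgroup S (A \<times>\<times> B)"
  using group_hom.img_is_subgroup[OF \<mu>_group_hom] by (simp add: S_def)

lemma K_normal: "K \<lhd> A \<times>\<times> B"
  unfolding K_def by (rule A.DirProd_normal[OF B.group_axioms K\<^sub>1.normal_axioms K\<^sub>2.normal_axioms])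

sublocale KS: second_isomorphism_grp K "A \<times>\<times> B" S
  using K_normal S_subgroup
  by (simp add: second_isomorphism_grp_def second_isomorphism_grp_axioms_def)

lemma X_subgroup: "subgroup (K <#>\<^bsub>A \<times>\<times> B\<^esub> S) (A \<times>\<times> B)"
  by (rule KS.normal_set_mult_subgroup)

sublocale X: group X
  unfolding X_def by (rule subgroup.subgroup_is_group[OF X_subgroup AB.group_axioms])

lemma carrier_X:
  "x \<in> carrier X \<longleftrightarrow> (\<exists>k\<in>K\<^sub>1. \<exists>l\<in>K\<^sub>2. \<exists>h\<in>S\<^sub>1. x = (k \<otimes>\<^bsub>A\<^esub> h, l \<otimes>\<^bsub>B\<^esub> \<mu> h))"
  by (auto simp: X_def K_def S_def set_mult_def)

lemma carrier_X_subset: "carrier X \<subseteq> carrier A \<times> carrier B"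
  using subgroup.subset[OF X_subgroup] by (simp add: X_def)

lemma fst_hom: "fst \<in> hom X A" and snd_hom: "snd \<in> hom X B"
  using carrier_X_subset by (auto simp: hom_def X_def mult_DirProd')

sublocale p: group_hom X A fst by unfold_locales (rule fst_hom)
sublocale q: group_hom X B snd by unfold_locales (rule snd_hom)

lemma fst_S: "fst ` S = S\<^sub>1" and snd_S: "snd ` S = S\<^sub>2"
  using \<mu>_image by (auto simp: S_def image_image)

lemma fst_K: "fst ` K = K\<^sub>1" and snd_K: "snd ` K = K\<^sub>2"
  unfolding K_def fst_image_times snd_image_times
  using K\<^sub>1.one_closed K\<^sub>2.one_closed by (metis empty_iff)+

text \<open>Transitivity of the plinth writes \<open>a\<close> as \<open>k \<otimes> h\<close>, and
  \<open>\<mu> h\<close> serves as second coordinate of a lift. The other projection is treated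
  alike, using that \<open>\<mu>\<close> is onto \<open>S\<^sub>2\<close>.\<close>

lemma fst_X: "fst ` carrier X = carrier A"
proof (intro equalityI subsetI)
  fix a assume "a \<in> carrier A"
  with A(2) obtain k h where "k \<in> K\<^sub>1" "h \<in> S\<^sub>1" "a = k \<otimes>\<^bsub>A\<^esub> h"
    unfolding plinth_pair_def using supplementD by metis
  then have "(a, \<one>\<^bsub>B\<^esub> \<otimes>\<^bsub>B\<^esub> \<mu> h) \<in> carrier X" using K\<^sub>2.one_closed carrier_X by blast
  then show "a \<in> fst ` carrier X" by force
qed (use p.hom_closed in blast)

lemma snd_X: "snd ` carrier X = carrier B"
proof (intro equalityI subsetI)
  fix b assume "b \<in> carrier B"
  with B(2) obtain l h where "l \<in> K\<^sub>2" "h \<in> S\<^sub>2" "b = l \<otimes>\<^bsub>B\<^esub> h"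
    unfolding plinth_pair_def using supplementD by metis
  moreover obtain h' where "h' \<in> S\<^sub>1" "h = \<mu> h'" using \<open>h \<in> S\<^sub>2\<close> \<mu>_image by blast
  ultimately have "(\<one>\<^bsub>A\<^esub> \<otimes>\<^bsub>A\<^esub> h', b) \<in> carrier X" using K\<^sub>1.one_closed carrier_X by blast
  then show "b \<in> snd ` carrier X" by force
qed (use q.hom_closed in blast)

sublocale subdirect_pair X A fst B snd S K
proof (intro subdirect_pair.intro subdirect_pair_axioms.intro)
  show "group_hom X A fst" "group_hom X B snd"
    by (rule p.group_hom_axioms q.group_hom_axioms)+
  show "fst ` carrier X = carrier A" "snd ` carrier X = carrier B" by (rule fst_X snd_X)+
  show "x = \<one>\<^bsub>X\<^esub>" if "fst x = \<one>\<^bsub>A\<^esub>" "snd x = \<one>\<^bsub>B\<^esub>" for x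
    using that by (simp add: X_def prod_eq_iff)
  show "subgroup S X"
    unfolding X_def using AB.subgroup_incl[OF S_subgroup X_subgroup KS.S_contained_in_set_mult] .
  show "inj_on fst S" by (auto simp: S_def inj_on_def)
  show "inj_on snd S" using \<mu>_inj by (auto simp: S_def inj_on_def)
  show "K \<lhd> X"
    unfolding X_def
    using AB.normal_restrict_supergroup[OF X_subgroup K_normal KS.H_contained_in_set_mult] .
  show "supplement X S K" by (simp add: supplement_def X_def set_mult_def)
  show "\<exists>k'\<in>K. fst k' = fst k \<and> snd k' = \<one>\<^bsub>B\<^esub>" if "k \<in> K" for k
    using that K\<^sub>2.one_closed by (auto simp: K_def)
  \<comment> \<open>Here the compatibility of \<open>\<mu>\<close> with the plinths enters: a
    trivial second coordinate makes \<open>\<mu> h\<close> the inverse of \<open>l\<close>, an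
    element of \<open>K\<^sub>2 \<inter> S\<^sub>2\<close> and so the image of an element of
    \<open>K\<^sub>1 \<inter> S\<^sub>1\<close>. Hence \<open>h\<close> lies in
    \<open>K\<^sub>1\<close>.\<close>
  show "x \<in> K" if x: "x \<in> carrier X" "snd x = \<one>\<^bsub>B\<^esub>" for x
  proof -
    obtain k l h where k: "k \<in> K\<^sub>1" "l \<in> K\<^sub>2" "h \<in> S\<^sub>1" "x = (k \<otimes>\<^bsub>A\<^esub> h, l \<otimes>\<^bsub>B\<^esub> \<mu> h)"
      using x carrier_X by blast
    have mem: "\<mu> h \<in> S\<^sub>2" "\<mu> h \<in> carrier B" "l \<in> carrier B"
      using k \<mu>_mem S\<^sub>2.mem_carrier K\<^sub>2.mem_carrier by blast+
    have "inv\<^bsub>B\<^esub> (\<mu> h) = l"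
      using k x(2) mem by (intro B.inv_equality) simp_all
    then have "\<mu> h = inv\<^bsub>B\<^esub> l" using mem by force
    then have "\<mu> h \<in> \<mu> ` (K\<^sub>1 \<inter> S\<^sub>1)" using k mem \<mu>_K by simp
    then have "h \<in> K\<^sub>1" using \<mu>_inj k by (auto dest: inj_onD)
    then show "x \<in> K" using k x(2) by (simp add: K_def)
  qed
  show "semiprimitive_pair A (fst ` S)" "plinth_pair A (fst ` S) (fst ` K)"
    "semiprimitive_pair B (snd ` S)" "plinth_pair B (snd ` S) (snd ` K)"
    using A B by (simp_all add: fst_S snd_S fst_K snd_K)
qed

end

section \<open>Realisation as a permutation group on cosets\<close>

theorem corollary4p12:
  fixes \<Omega>\<^sub>1 :: "'a set" and G\<^sub>1 K\<^sub>1 :: "('a \<Rightarrow> 'a) set" and \<omega>\<^sub>1 :: 'a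
    and \<Omega>\<^sub>2 :: "'b set" and G\<^sub>2 K\<^sub>2 :: "('b \<Rightarrow> 'b) set" and \<omega>\<^sub>2 :: 'b
    and \<mu> :: "('a \<Rightarrow> 'a) \<Rightarrow> ('b \<Rightarrow> 'b)"
  assumes "semiprimitive \<Omega>\<^sub>1 G\<^sub>1" and "semiprimitive \<Omega>\<^sub>2 G\<^sub>2"
    and "plinth \<Omega>\<^sub>1 G\<^sub>1 K\<^sub>1" and "plinth \<Omega>\<^sub>2 G\<^sub>2 K\<^sub>2"
    and "\<omega>\<^sub>1 \<in> \<Omega>\<^sub>1" and "\<omega>\<^sub>2 \<in> \<Omega>\<^sub>2"
    and "\<mu> \<in> iso (perm_group \<Omega>\<^sub>1 (point_stabilizer \<Omega>\<^sub>1 G\<^sub>1 \<omega>\<^sub>1))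
                 (perm_group \<Omega>\<^sub>2 (point_stabilizer \<Omega>\<^sub>2 G\<^sub>2 \<omega>\<^sub>2))"
    and "\<mu> ` point_stabilizer \<Omega>\<^sub>1 K\<^sub>1 \<omega>\<^sub>1 = point_stabilizer \<Omega>\<^sub>2 K\<^sub>2 \<omega>\<^sub>2"
  shows "\<exists>(\<Omega> :: ('a, 'b) pair_coset set) G.
    \<Omega> \<noteq> {} \<and> semiprimitive \<Omega> G \<and>
    (\<exists>K. plinth \<Omega> G K \<and>
      perm_group \<Omega> K \<cong> perm_group \<Omega>\<^sub>1 K\<^sub>1 \<times>\<times> perm_group \<Omega>\<^sub>2 K\<^sub>2) \<and>
    (\<forall>\<omega>\<in>\<Omega>. perm_group \<Omega> (point_stabilizer \<Omega> G \<omega>) \<cong>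
      perm_group \<Omega>\<^sub>1 (point_stabilizer \<Omega>\<^sub>1 G\<^sub>1 \<omega>\<^sub>1)) \<and>
    is_quotient_action_of \<Omega>\<^sub>1 G\<^sub>1 \<Omega> G \<and>
    is_quotient_action_of \<Omega>\<^sub>2 G\<^sub>2 \<Omega> G"
proof -
  interpret P\<^sub>1: transitive_perm_group \<Omega>\<^sub>1 G\<^sub>1 \<omega>\<^sub>1
    using assms by unfold_locales (simp_all add: semiprimitive_def)
  interpret P\<^sub>2: transitive_perm_group \<Omega>\<^sub>2 G\<^sub>2 \<omega>\<^sub>2
    using assms by unfold_locales (simp_all add: semiprimitive_def)
  have "K\<^sub>1 \<subseteq> G\<^sub>1"
    using assms(3) subgroup.subset[OF normal_imp_subgroup[of K\<^sub>1 P\<^sub>1.P]] by (simp add: plinth_def)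
  moreover have "K\<^sub>2 \<subseteq> G\<^sub>2"
    using assms(4) subgroup.subset[OF normal_imp_subgroup[of K\<^sub>2 P\<^sub>2.P]] by (simp add: plinth_def)
  ultimately have K_stab: "point_stabilizer \<Omega>\<^sub>1 K\<^sub>1 \<omega>\<^sub>1 = K\<^sub>1 \<inter> P\<^sub>1.S"
    "point_stabilizer \<Omega>\<^sub>2 K\<^sub>2 \<omega>\<^sub>2 = K\<^sub>2 \<inter> P\<^sub>2.S"
    by (auto simp: point_stabilizer_eq)
  interpret M: stabilizer_matching P\<^sub>1.P P\<^sub>2.P P\<^sub>1.S P\<^sub>2.S K\<^sub>1 K\<^sub>2 \<mu>
    using assms K_stab P\<^sub>1.semiprimitive_iff_pair P\<^sub>1.plinth_iff_pair
      P\<^sub>2.semiprimitive_iff_pair P\<^sub>2.plinth_iff_pair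
    by unfold_locales simp_all
  \<comment> \<open>The first projection is onto, so it sends an element of the core into every
    conjugate of the stabiliser of \<open>\<omega>\<^sub>1\<close>. By transitivity its image fixes
    all of \<open>\<Omega>\<^sub>1\<close>; the projection being injective on the graph, the element
    is trivial.\<close>
  interpret C: core_free_subgroup M.X M.S
  proof
    fix x assume x: "x \<in> M.S" and
      conj: "\<And>g. g \<in> carrier M.X \<Longrightarrow> inv\<^bsub>M.X\<^esub> g \<otimes>\<^bsub>M.X\<^esub> x \<otimes>\<^bsub>M.X\<^esub> g \<in> M.S"
    have xX: "x \<in> carrier M.X" using x by (rule M.H.mem_carrier)
    have fx: "fst x \<in> G\<^sub>1" using M.p.hom_closed[OF xX] by simp
    have "fst x y = y" if y: "y \<in> \<Omega>\<^sub>1" for y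
    proof -
      obtain d where d: "d \<in> G\<^sub>1" "d \<omega>\<^sub>1 = y" using P\<^sub>1.move[OF P\<^sub>1.point y] by blast
      then have "d \<in> fst ` carrier M.X" using M.fst_X by simp
      then obtain g where g: "g \<in> carrier M.X" "d = fst g" by blast
      then have "fst (inv\<^bsub>M.X\<^esub> g \<otimes>\<^bsub>M.X\<^esub> x \<otimes>\<^bsub>M.X\<^esub> g) \<in> P\<^sub>1.S"
        using conj M.fst_S by blast
      moreover have "fst (inv\<^bsub>M.X\<^esub> g \<otimes>\<^bsub>M.X\<^esub> x \<otimes>\<^bsub>M.X\<^esub> g) =
          inv\<^bsub>P\<^sub>1.P\<^esub> d \<otimes>\<^bsub>P\<^sub>1.P\<^esub> fst x \<otimes>\<^bsub>P\<^sub>1.P\<^esub> d"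
        using g xX by simp
      ultimately have "(inv\<^bsub>P\<^sub>1.P\<^esub> d \<otimes>\<^bsub>P\<^sub>1.P\<^esub> fst x \<otimes>\<^bsub>P\<^sub>1.P\<^esub> d) \<omega>\<^sub>1 = \<omega>\<^sub>1"
        by (simp add: point_stabilizer_eq)
      then have "(inv\<^bsub>P\<^sub>1.P\<^esub> d) (fst x y) = \<omega>\<^sub>1"
        using d fx y P\<^sub>1.inv_closed[of d] P\<^sub>1.m_closed[of "inv\<^bsub>P\<^sub>1.P\<^esub> d" "fst x"] P\<^sub>1.point
        by (simp add: P\<^sub>1.mult_apply)
      then show ?thesis
        using P\<^sub>1.inv_apply[of d \<omega>\<^sub>1 "fst x y"] d fx y P\<^sub>1.point P\<^sub>1.apply_closed by simp
    qed
    then have "fst x = \<one>\<^bsub>P\<^sub>1.P\<^esub>"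
      using fx P\<^sub>1.one_closed by (intro P\<^sub>1.eqI) simp_all
    then show "x = \<one>\<^bsub>M.X\<^esub>"
      using x M.p_inj M.H.one_closed M.p.hom_one by (metis inj_onD)
  qed
  let ?\<Omega> = C.cosets and ?G = "C.act ` carrier M.X" and ?K = "C.act ` M.K"
  \<comment> \<open>The base point is the coset \<open>M.S\<close> itself, with stabiliser the image
    of \<open>M.S\<close>.\<close>
  interpret G: transitive_perm_group ?\<Omega> ?G M.S
    using C.act_transitive C.base by unfold_locales
  have "semiprimitive ?\<Omega> ?G"
    unfolding G.semiprimitive_iff_pair C.act_stabilizer_base
    by (rule iso_semiprimitive_pair[OF M.X.group_axioms G.group_axioms C.act_iso
          M.semiprimitive_pair_subdirect])
  moreover have "plinth ?\<Omega> ?G ?K"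
    unfolding G.plinth_iff_pair C.act_stabilizer_base
    by (rule iso_plinth_pair[OF M.X.group_axioms G.group_axioms C.act_iso M.H.subset
          M.plinth_pair_subdirect])
  moreover have "perm_group ?\<Omega> ?K \<cong> perm_group \<Omega>\<^sub>1 K\<^sub>1 \<times>\<times> perm_group \<Omega>\<^sub>2 K\<^sub>2"
  proof -
    \<comment> \<open>Multiplication in a direct product is componentwise and does not depend on the
      carriers, so both sides are the same record.\<close>
    have DP: "perm_group \<Omega>\<^sub>1 K\<^sub>1 \<times>\<times> perm_group \<Omega>\<^sub>2 K\<^sub>2 = M.X\<lparr>carrier := M.K\<rparr>"
      by (simp add: M.X_def M.K_def DirProd_def)
    have "C.act \<in> iso (M.X\<lparr>carrier := M.K\<rparr>) (perm_group ?\<Omega> ?K)"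
      using C.act_mult inj_on_subset[OF C.act_inj M.K.subset]
      by (auto simp: iso_def hom_def bij_betw_def)
    then show ?thesis
      unfolding DP
      using group.iso_sym[OF subgroup.subgroup_is_group[OF M.K.is_subgroup M.X.group_axioms]]
      by (auto simp: is_iso_def)
  qed
  moreover have "perm_group ?\<Omega> (point_stabilizer ?\<Omega> ?G C) \<cong> perm_group \<Omega>\<^sub>1 P\<^sub>1.S"
    if C: "C \<in> ?\<Omega>" for C
  proof -
    \<comment> \<open>The first projection identifies the graph of \<open>\<mu>\<close> with its
      domain.\<close>
    have "fst \<in> iso (M.X\<lparr>carrier := M.S\<rparr>) (perm_group \<Omega>\<^sub>1 P\<^sub>1.S)"
      using M.p_inj M.fst_S M.p.hom_mult M.H.mem_carrier
      by (auto simp: iso_def hom_def bij_betw_def)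
    then have "M.X\<lparr>carrier := M.S\<rparr> \<cong> perm_group \<Omega>\<^sub>1 P\<^sub>1.S" by (rule is_isoI)
    then show ?thesis using C.act_stabilizer_iso[OF C] iso_trans by blast
  qed
  \<comment> \<open>Each projection of \<open>M.X\<close> is onto and maps the graph onto the given
    point stabiliser, as the coset criterion requires.\<close>
  moreover have "is_quotient_action_of \<Omega>\<^sub>1 G\<^sub>1 ?\<Omega> ?G"
    using C.coset_action_quotient[OF P\<^sub>1.transitive_perm_group_axioms M.fst_hom] M.fst_X M.fst_S by simp
  moreover have "is_quotient_action_of \<Omega>\<^sub>2 G\<^sub>2 ?\<Omega> ?G"
    using C.coset_action_quotient[OF P\<^sub>2.transitive_perm_group_axioms M.snd_hom] M.snd_X M.snd_S by simp
  ultimately show ?thesis using C.base by blast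
qed

end
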